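(* Let $m_0,m_1\in\mathbb{R}^d$, let $\Sigma\in\mathbb{R}^{d\times d}$ be symmetric positive definite, and let $P_0=\mathcal{N}(m_0,\Sigma)$, $P_1=\mathcal{N}(m_1,\Sigma)$. Define $F(t,x,y,z)=(1-t)x+ty+\sqrt{2t(1-t)}\,z$ (with $z\in\mathbb{R}^d$) and $Q=\mathcal{N}(0,\Sigma)$. Then $(F,Q)\in\mathcal{F}_{\mathrm{SL}}(P_0,P_1)$.
   Context: Fix $1\le p<2$. A base interpolation path is a Borel map $F:[0,1]\times\mathbb{R}^{2d+\ell}\to\mathbb{R}^d$ such that for Lebesgue-a.e. $(x,y,z)$, $t\mapsto F(t,x,y,z)\in W^{1,p}([0,1];\mathbb{R}^d)$, $F(0,x,y,z)=x$ and $F(1,x,y,z)=y$. A generalized interpolant is a pair $(F,Q)$ with $F$ a base interpolation path and $Q$ an absolutely continuous probability measure on $\mathbb{R}^\ell$; given $P_0,P_1$ it induces the process $X_t=F(t,X_0,X_1,Z)$ with $(X_0,X_1,Z)\sim P_0\otimes P_1\otimes Q$. $\mathcal{S}(P_0,P_1)$ is the class of $\mathbb{R}^d$-valued processes $(X_t)_{t\in[0,1]}$ with a.s. continuous sample paths and $(X_0,X_1)\sim P_0\otimes P_1$. For absolutely continuous $P_0,P_1$, $\mathcal{S}_{\mathrm{SL}}(P_0,P_1)$ is the set of $X\in\mathcal{S}(P_0,P_1)$ whose conditional velocity $v(t,x)=\mathbb{E}[\dot X_t\mid X_t=x]$ is well defined, jointly measurable, and satisfies $\|v(t,x)-v(t,y)\|\le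 L\|x-y\|$ for some $L>0$ and all $t,x,y$, and whose flow map ($\partial_t\phi(t,x)=v(t,\phi(t,x))$, $\phi(0,x)=x$) satisfies $\partial_t^2\phi(t,x)=0$ for all $(t,x)\in[0,1]\times\mathbb{R}^d$. $\mathcal{F}_{\mathrm{SL}}(P_0,P_1)$ is the set of generalized interpolants whose induced process lies in $\mathcal{S}_{\mathrm{SL}}(P_0,P_1)$. *)

theory Defs
  imports "HOL-Probability.Probability"
begin

definition mvn_pdf :: "real^'d \<Rightarrow> real^'d^'d \<Rightarrow> real^'d \<Rightarrow> real" where
  "mvn_pdf m S x =
     exp (- ((x - m) \<bullet> (matrix_inv S *v (x - m))) / 2)
     / sqrt ((2 * pi) ^ CARD('d) * det S)"

definition mvn :: "real^'d \<Rightarrow> real^'d^'d \<Rightarrow> (real^'d) measure" where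
  "mvn m S = density lborel (\<lambda>x. ennreal (mvn_pdf m S x))"

definition sym_posdef :: "real^'d^'d \<Rightarrow> bool" where
  "sym_posdef S \<longleftrightarrow> transpose S = S \<and> (\<forall>x. x \<noteq> 0 \<longrightarrow> x \<bullet> (S *v x) > 0)"

definition ac_prob :: "'a::euclidean_space measure \<Rightarrow> bool" where
  "ac_prob P \<longleftrightarrow> prob_space P \<and> sets P = sets borel \<and> absolutely_continuous lborel P"

(* W^{1,p}([0,1];R^d), via its absolutely continuous representative:
   f(t) = f(0) + \<integral>_0^t g with g \<in> L^p([0,1]) *)
definition W1p :: "real \<Rightarrow> (real \<Rightarrow> 'a::euclidean_space) \<Rightarrow> bool" where
  "W1p p f \<longleftrightarrow> (\<exists>g. g absolutely_integrable_on {0..1}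
      \<and> (\<lambda>t. norm (g t) powr p) integrable_on {0..1}
      \<and> (\<forall>t\<in>{0..1}. f t = f 0 + integral {0..t} g))"

definition base_path ::
  "real \<Rightarrow> (real \<Rightarrow> 'a::euclidean_space \<Rightarrow> 'a \<Rightarrow> 'l::euclidean_space \<Rightarrow> 'a) \<Rightarrow> bool" where
  "base_path p F \<longleftrightarrow>
     (\<lambda>(t, x, y, z). F t x y z) \<in> borel_measurable (restrict_space borel ({0..1} \<times> UNIV))
   \<and> (AE (x, y, z) in lborel.
        W1p p (\<lambda>t. F t x y z) \<and> F 0 x y z = x \<and> F 1 x y z = y)"

definition in_S :: "'w measure \<Rightarrow> (real \<Rightarrow> 'w \<Rightarrow> 'a::euclidean_space)
    \<Rightarrow> 'a measure \<Rightarrow> 'a measure \<Rightarrow> bool" where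
  "in_S M X P0 P1 \<longleftrightarrow> prob_space M
     \<and> (\<forall>t\<in>{0..1}. X t \<in> borel_measurable M)
     \<and> (AE \<omega> in M. continuous_on {0..1} (\<lambda>t. X t \<omega>))
     \<and> distr M (borel \<Otimes>\<^sub>M borel) (\<lambda>\<omega>. (X 0 \<omega>, X 1 \<omega>)) = P0 \<Otimes>\<^sub>M P1"

(* v(t,x) = E[Xdot_t | X_t = x], characterised by the defining property of conditional
   expectation, at every time t in (0,1) (where the paths are a.s. differentiable). *)
definition is_cond_velocity :: "'w measure \<Rightarrow> (real \<Rightarrow> 'w \<Rightarrow> 'a::euclidean_space)
    \<Rightarrow> (real \<Rightarrow> 'a \<Rightarrow> 'a) \<Rightarrow> bool" where
  "is_cond_velocity M X v \<longleftrightarrow>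
     (\<lambda>(t, x). v t x) \<in> borel_measurable borel
   \<and> (\<forall>t\<in>{0<..<1}.
        (AE \<omega> in M. (\<lambda>s. X s \<omega>) differentiable (at t))
      \<and> integrable M (\<lambda>\<omega>. vector_derivative (\<lambda>s. X s \<omega>) (at t))
      \<and> integrable M (\<lambda>\<omega>. v t (X t \<omega>))
      \<and> (\<forall>A\<in>sets borel.
           (\<integral>\<omega>. indicator A (X t \<omega>) *\<^sub>R vector_derivative (\<lambda>s. X s \<omega>) (at t) \<partial>M)
         = (\<integral>\<omega>. indicator A (X t \<omega>) *\<^sub>R v t (X t \<omega>) \<partial>M)))"

definition in_S_SL :: "'w measure \<Rightarrow> (real \<Rightarrow> 'w \<Rightarrow> 'a::euclidean_space)
    \<Rightarrow> 'a measure \<Rightarrow> 'a measure \<Rightarrow> bool" where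
  "in_S_SL M X P0 P1 \<longleftrightarrow>
     ac_prob P0 \<and> ac_prob P1 \<and> in_S M X P0 P1
   \<and> (\<exists>v. is_cond_velocity M X v
        \<and> (\<exists>L>0. \<forall>t\<in>{0..1}. \<forall>x y. norm (v t x - v t y) \<le> L * norm (x - y))
        \<and> (\<exists>\<phi> \<phi>'. (\<forall>x. \<phi> 0 x = x)
             \<and> (\<forall>x. \<forall>t\<in>{0..1}. \<phi>' t x = v t (\<phi> t x))
             \<and> (\<forall>x. \<forall>t\<in>{0..1}. ((\<lambda>s. \<phi> s x) has_vector_derivative \<phi>' t x) (at t within {0..1}))
             \<and> (\<forall>x. \<forall>t\<in>{0..1}. ((\<lambda>s. \<phi>' s x) has_vector_derivative 0) (at t within {0..1}))))"

definition induced_space :: "'a::euclidean_space measure \<Rightarrow> 'a measure \<Rightarrow> 'l measure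
    \<Rightarrow> ('a \<times> 'a \<times> 'l) measure" where
  "induced_space P0 P1 Q = P0 \<Otimes>\<^sub>M (P1 \<Otimes>\<^sub>M Q)"

definition induced_process :: "(real \<Rightarrow> 'a \<Rightarrow> 'a \<Rightarrow> 'l \<Rightarrow> 'a)
    \<Rightarrow> real \<Rightarrow> ('a \<times> 'a \<times> 'l) \<Rightarrow> 'a" where
  "induced_process F t \<omega> = (case \<omega> of (x, y, z) \<Rightarrow> F t x y z)"

definition in_F_SL :: "real \<Rightarrow> (real \<Rightarrow> 'a::euclidean_space \<Rightarrow> 'a \<Rightarrow> 'l::euclidean_space \<Rightarrow> 'a)
    \<Rightarrow> 'l measure \<Rightarrow> 'a measure \<Rightarrow> 'a measure \<Rightarrow> bool" where
  "in_F_SL p F Q P0 P1 \<longleftrightarrow> base_path p F \<and> ac_prob Q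
     \<and> in_S_SL (induced_space P0 P1 Q) (induced_process F) P0 P1"

end

theory Submission
  imports Defs
begin

text \<open>The bridge \<open>X\<^sub>t = (1 - t) X\<^sub>0 + t X\<^sub>1 + c\<^sub>t Z\<close> with \<open>c\<^sub>t = sqrt (2 t (1 - t))\<close> has constant
  covariance \<open>\<Sigma>\<close>, because \<open>(1 - t)\<^sup>2 + t\<^sup>2 + c\<^sub>t\<^sup>2 = 1\<close>.  Hence \<open>X\<^sub>t\<close> is uncorrelated with its
  velocity, and the conditional velocity is the constant \<open>m\<^sub>1 - m\<^sub>0\<close>, with flow
  \<open>x + t (m\<^sub>1 - m\<^sub>0)\<close>.  This follows from a symmetry: with
  \<open>e = (1 - 2 t) / c\<^sub>t\<close>, the coefficient vectors \<open>(1 - t, t, c\<^sub>t)\<close> of \<open>X\<^sub>t\<close> and \<open>(-1, 1, e)\<close> of the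
  velocity are orthogonal, so the reflection of \<open>(X\<^sub>0 - m\<^sub>0, X\<^sub>1 - m\<^sub>1, Z)\<close> along \<open>(-1, 1, e)\<close> fixes
  \<open>X\<^sub>t\<close>, negates the centred velocity, and preserves the Gaussian law.  The restriction
  \<open>p < 2\<close> makes \<open>(t (1 - t)) powr (- p / 2)\<close>, a bound for the \<open>p\<close>-th power of the velocity,
  integrable.\<close>

subsection \<open>Linear changes of variables for Lebesgue measure\<close>

lemma nn_integral_lborel_add:
  fixes h :: "'a::euclidean_space \<Rightarrow> ennreal"
  assumes [measurable]: "h \<in> borel_measurable borel"
  shows "(\<integral>\<^sup>+x. h (x + a) \<partial>lborel) = (\<integral>\<^sup>+x. h x \<partial>lborel)"
  by (subst (2) lborel_distr_plus[of a, symmetric]) (simp add: nn_integral_distr add.commute)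

lemma nn_integral_lborel_uminus:
  fixes h :: "'a::euclidean_space \<Rightarrow> ennreal"
  assumes [measurable]: "h \<in> borel_measurable borel"
  shows "(\<integral>\<^sup>+x. h (- x) \<partial>lborel) = (\<integral>\<^sup>+x. h x \<partial>lborel)"
proof -
  have "lborel = distr lborel borel (uminus :: 'a \<Rightarrow> 'a)"
    using lborel_affine[of "-1" "0::'a"] by (simp add: density_1)
  then have "(\<integral>\<^sup>+x. h x \<partial>lborel) = (\<integral>\<^sup>+x. h x \<partial>distr lborel borel (uminus :: 'a \<Rightarrow> 'a))"
    by simp
  then show ?thesis by (simp add: nn_integral_distr)
qed

text \<open>As \<open>c\<close> is orthogonal to \<open>b\<close>, the displacement along
  \<open>b\<close> depends only on the other coordinates. Integrating along \<open>b\<close> first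
  therefore meets a mere translation. This handles elementary row additions below.\<close>

lemma nn_integral_lborel_transvection:
  fixes h :: "'a::euclidean_space \<Rightarrow> ennreal"
  assumes [measurable]: "h \<in> borel_measurable borel" and b: "b \<in> Basis" and "c \<bullet> b = 0"
  shows "(\<integral>\<^sup>+x. h (x + (x \<bullet> c) *\<^sub>R b) \<partial>lborel) = (\<integral>\<^sup>+x. h x \<partial>lborel)"
proof -
  let ?I = "Basis - {b}"
  interpret product_sigma_finite "\<lambda>_::'a. lborel :: real measure"
    by unfold_locales
  have ins: "insert b ?I = Basis" using b by auto
  \<comment> \<open>Tonelli in coordinates: the coordinate along \<open>b\<close> becomes the inner
    integral.\<close>
  have split: "(\<integral>\<^sup>+x. g x \<partial>lborel) =
      (\<integral>\<^sup>+x. (\<integral>\<^sup>+y. g ((\<Sum>j\<in>?I. x j *\<^sub>R j) + y *\<^sub>R b) \<partial>lborel) \<partial>Pi\<^sub>M ?I (\<lambda>_. lborel))"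
    if [measurable]: "g \<in> borel_measurable borel" for g :: "'a \<Rightarrow> ennreal"
  proof -
    have sum_upd: "(\<Sum>j\<in>Basis. (x(b := y)) j *\<^sub>R j) = (\<Sum>j\<in>?I. x j *\<^sub>R j) + y *\<^sub>R b"
      for x :: "'a \<Rightarrow> real" and y
      using b by (subst sum.remove[OF _ b]) (auto intro!: sum.cong)
    have "(\<integral>\<^sup>+x. g x \<partial>lborel) =
        (\<integral>\<^sup>+x. g (\<Sum>j\<in>Basis. x j *\<^sub>R j) \<partial>Pi\<^sub>M (insert b ?I) (\<lambda>_. lborel))"
      by (subst lborel_eq) (simp only: ins, simp add: nn_integral_distr)
    also have "\<dots> = (\<integral>\<^sup>+x. (\<integral>\<^sup>+y. g (\<Sum>j\<in>Basis. (x(b := y)) j *\<^sub>R j) \<partial>lborel)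
        \<partial>Pi\<^sub>M ?I (\<lambda>_. lborel))"
      by (subst product_nn_integral_insert) (auto simp: ins)
    finally show ?thesis unfolding sum_upd .
  qed
  have "(\<integral>\<^sup>+y. h ((\<Sum>j\<in>?I. x j *\<^sub>R j) + y *\<^sub>R b + (((\<Sum>j\<in>?I. x j *\<^sub>R j) + y *\<^sub>R b) \<bullet> c) *\<^sub>R b) \<partial>lborel)
      = (\<integral>\<^sup>+y. h ((\<Sum>j\<in>?I. x j *\<^sub>R j) + y *\<^sub>R b) \<partial>lborel)" (is "?L = _") for x :: "'a \<Rightarrow> real"
  proof -
    have "?L = (\<integral>\<^sup>+y. h ((\<Sum>j\<in>?I. x j *\<^sub>R j) + (y + (\<Sum>j\<in>?I. x j *\<^sub>R j) \<bullet> c) *\<^sub>R b) \<partial>lborel)"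
      using \<open>c \<bullet> b = 0\<close> by (simp add: inner_add_left inner_commute[of b] algebra_simps)
    also have "\<dots> = (\<integral>\<^sup>+y. h ((\<Sum>j\<in>?I. x j *\<^sub>R j) + y *\<^sub>R b) \<partial>lborel)"
      by (rule nn_integral_lborel_add) measurable
    finally show ?thesis .
  qed
  then show ?thesis by (subst (1 2) split) simp_all
qed

lemma borel_measurable_matrix_vector_mult [measurable]:
  "(*v) A \<in> borel_measurable borel" for A :: "real^'n^'m"
  by (intro borel_measurable_continuous_onI matrix_vector_mult_linear_continuous_on)

text \<open>The change of variables theorems in \<^theory>\<open>HOL-Analysis.Change_Of_Vars\<close> require a
  well-ordered index type, whereas \<open>'n\<close> is merely finite here.\<close>
lemma nn_integral_lborel_matrix:
  fixes A :: "real^'n^'n" and h :: "real^'n \<Rightarrow> ennreal"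
  assumes "det A \<noteq> 0" and "h \<in> borel_measurable borel"
  shows "(\<integral>\<^sup>+x. h x \<partial>lborel) = ennreal \<bar>det A\<bar> * (\<integral>\<^sup>+x. h (A *v x) \<partial>lborel)"
proof -
  \<comment> \<open>Singular matrices satisfy \<open>P\<close> vacuously, so the induction over
    elementary matrices may use arbitrary factors; a nonsingular product has nonsingular
    factors.\<close>
  define P :: "real^'n^'n \<Rightarrow> bool" where "P A \<longleftrightarrow> (det A \<noteq> 0 \<longrightarrow> (\<forall>h\<in>borel_measurable borel.
    (\<integral>\<^sup>+x. h x \<partial>lborel) = ennreal \<bar>det A\<bar> * (\<integral>\<^sup>+x. h (A *v x) \<partial>lborel)))" for A
  have Basis: "Basis = (\<lambda>i::'n. axis i (1::real)) ` UNIV"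
    by (auto simp: Basis_vec_def)
  have inj: "inj (\<lambda>i::'n. axis i (1::real))" by (auto simp: inj_def axis_eq_axis)
  have "P A"
  proof (rule induct_matrix_elementary_alt[of P])
    fix A B :: "real^'n^'n" assume PA: "P A" and PB: "P B"
    show "P (A ** B)" unfolding P_def
    proof (intro impI ballI)
      fix h :: "real^'n \<Rightarrow> ennreal" assume [measurable]: "h \<in> borel_measurable borel"
      assume "det (A ** B) \<noteq> 0"
      then have "det A \<noteq> 0" "det B \<noteq> 0" by (auto simp: det_mul)
      then have "(\<integral>\<^sup>+x. h x \<partial>lborel) = ennreal \<bar>det A\<bar> * (ennreal \<bar>det B\<bar> * (\<integral>\<^sup>+x. h (A *v (B *v x)) \<partial>lborel))"
        using PA PB unfolding P_def
        by (smt (verit, del_insts) borel_measurable_matrix_vector_mult \<open>h \<in> borel_measurable borel\<close>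
            measurable_compose nn_integral_cong)
      then show "(\<integral>\<^sup>+x. h x \<partial>lborel) = ennreal \<bar>det (A ** B)\<bar> * (\<integral>\<^sup>+x. h ((A ** B) *v x) \<partial>lborel)"
        by (simp add: det_mul abs_mult ennreal_mult matrix_vector_mul_assoc mult.assoc)
    qed
  next
    fix A :: "real^'n^'n" and i assume "row i A = 0"
    then show "P A" by (simp add: P_def det_zero_row)
  next
    fix A :: "real^'n^'n" assume dg: "\<And>i j. i \<noteq> j \<Longrightarrow> A $ i $ j = 0"
    then have det: "det A = (\<Prod>i\<in>UNIV. A $ i $ i)" by (rule det_diagonal)
    define c where "c b = b \<bullet> (A *v b)" for b
    have c: "c (axis i 1) = A $ i $ i" for i
      by (simp add: c_def inner_axis' matrix_vector_mult_basis column_def)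
    \<comment> \<open>A diagonal matrix scales each coordinate. The summand \<open>0\<close> is the
      shift in the affine scaling rule for Lebesgue measure applied below.\<close>
    have Av: "A *v x = 0 + (\<Sum>j\<in>Basis. (c j * (x \<bullet> j)) *\<^sub>R j)" for x
    proof -
      have "(\<Sum>j\<in>UNIV. A $ i $ j * x $ j) = (\<Sum>j\<in>UNIV. if j = i then A $ j $ j * x $ j else 0)" for i
        using dg by (intro sum.cong) auto
      moreover have "(\<Sum>j\<in>UNIV. (A $ j $ j * x $ j) * axis j 1 $ i) = A $ i $ i * x $ i" for i
        by (simp add: axis_def if_distrib cong: if_cong)
      ultimately show ?thesis
        unfolding Basis sum.reindex[OF inj] o_def c
        by (simp add: vec_eq_iff matrix_vector_mult_def inner_axis)
    qed
    show "P A" unfolding P_def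
    proof (intro impI ballI)
      fix h :: "real^'n \<Rightarrow> ennreal" assume [measurable]: "h \<in> borel_measurable borel"
      assume "det A \<noteq> 0"
      then have nz: "c j \<noteq> 0" if "j \<in> Basis" for j using that by (auto simp: Basis c det)
      have pr: "(\<Prod>j\<in>Basis. \<bar>c j\<bar>) = \<bar>det A\<bar>"
        unfolding Basis prod.reindex[OF inj] o_def c det by (simp add: abs_prod)
      have "lborel = density (distr lborel borel ((*v) A)) (\<lambda>_. ennreal \<bar>det A\<bar>)"
        using lborel_affine_euclidean[of c 0] nz unfolding Av[symmetric] pr by simp
      then have "(\<integral>\<^sup>+x. h x \<partial>lborel) = (\<integral>\<^sup>+x. h x \<partial>density (distr lborel borel ((*v) A)) (\<lambda>_. ennreal \<bar>det A\<bar>))"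
        by simp
      also have "\<dots> = ennreal \<bar>det A\<bar> * (\<integral>\<^sup>+x. h (A *v x) \<partial>lborel)"
        by (simp add: nn_integral_density nn_integral_distr nn_integral_cmult)
      finally show "(\<integral>\<^sup>+x. h x \<partial>lborel) = ennreal \<bar>det A\<bar> * (\<integral>\<^sup>+x. h (A *v x) \<partial>lborel)" .
    qed
  next
    fix m n :: 'n assume "m \<noteq> n"
    let ?t = "Transposition.transpose m n"
    let ?A = "(\<chi> i j. mat 1 $ i $ ?t j) :: real^'n^'n"
    have "\<bar>det ?A\<bar> = 1"
      by (simp add: det_permute_columns permutes_swap_id sign_swap_id abs_mult)
    have Av: "?A *v x = (\<chi> i. x $ ?t i)" for x :: "real^'n"
    proof -
      have "(if i = ?t j then 1 else 0) * x $ j = (if j = ?t i then x $ j else 0)" for i j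
        by auto
      then show ?thesis
        by (simp add: vec_eq_iff matrix_vector_mult_def mat_def)
    qed
    \<comment> \<open>Lebesgue measure is determined by its values on boxes, and swapping two
      coordinates only permutes the side lengths of a box.\<close>
    have "lborel = distr lborel borel ((*v) ?A)"
    proof (rule lborel_eqI)
      fix l u :: "real^'n" assume le: "\<And>b. b \<in> Basis \<Longrightarrow> l \<bullet> b \<le> u \<bullet> b"
      then have le': "l $ i \<le> u $ i" for i
        using le[of "axis i 1"] by (simp add: inner_axis axis_in_Basis_iff)
      have "(*v) ?A -` box l u = box (\<chi> i. l $ ?t i) (\<chi> i. u $ ?t i)"
        by (auto simp: Av mem_box_cart) (metis transpose_involutory)+
      then have "emeasure (distr lborel borel ((*v) ?A)) (box l u)
          = emeasure lborel (box (\<chi> i. l $ ?t i) (\<chi> i. u $ ?t i))"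
        by (subst emeasure_distr) auto
      also have "\<dots> = ennreal (\<Prod>i\<in>UNIV. (u - l) $ ?t i)"
        using le' by (subst emeasure_lborel_box)
          (auto simp: Basis prod.reindex[OF inj] inner_axis)
      also have "(\<Prod>i\<in>UNIV. (u - l) $ ?t i) = (\<Prod>i\<in>UNIV. (u - l) $ i)"
        using prod.permute[OF permutes_swap_id, of m UNIV n "\<lambda>i. (u - l) $ i"] by (simp add: o_def)
      also have "\<dots> = (\<Prod>b\<in>Basis. (u - l) \<bullet> b)"
        by (simp add: Basis prod.reindex[OF inj] inner_axis)
      finally show "emeasure (distr lborel borel ((*v) ?A)) (box l u) = (\<Prod>b\<in>Basis. (u - l) \<bullet> b)" .
    qed simp
    then have "(\<integral>\<^sup>+x. h x \<partial>lborel) = (\<integral>\<^sup>+x. h (?A *v x) \<partial>lborel)"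
      if "h \<in> borel_measurable borel" for h
      using nn_integral_distr[of "(*v) ?A" lborel borel h] that by simp
    then show "P ?A"
      unfolding P_def \<open>\<bar>det ?A\<bar> = 1\<close> ennreal_1 mult_1 by blast
  next
    fix m n :: 'n assume mn: "m \<noteq> n"
    let ?A = "(\<chi> i j. of_bool (i = m \<and> j = n \<or> i = j)) :: real^'n^'n"
    \<comment> \<open>\<open>?A\<close> arises from the identity by adding row \<open>n\<close> to
      row \<open>m\<close>, which keeps the determinant.\<close>
    have "?A = (\<chi> k. if k = m then row m (mat 1) + 1 *s row n (mat 1) else row k (mat 1))"
      using mn by (auto simp: vec_eq_iff row_def mat_def)
    then have det: "det ?A = 1" using det_row_operation[OF mn, of "mat 1" 1] by simp
    have Av: "?A *v x = x + (x \<bullet> axis n 1) *\<^sub>R axis m 1" for x :: "real^'n"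
    proof -
      have "of_bool (i = m \<and> j = n \<or> i = j) * x $ j = (if j = i then x $ j else 0) + (if j = n then (if i = m then x $ n else 0) else 0)" for i j
        using mn by auto
      then have "(?A *v x) $ i = x $ i + (if i = m then x $ n else 0)" for i
        by (simp add: matrix_vector_mult_def sum.distrib)
      moreover have "x \<bullet> axis n 1 = x $ n" by (simp add: inner_axis)
      ultimately show ?thesis
        by (simp add: vec_eq_iff axis_def)
    qed
    show "P ?A"
      unfolding P_def det Av using mn
      by (auto intro!: nn_integral_lborel_transvection[symmetric] simp: inner_axis_axis axis_in_Basis_iff)
  qed
  then show ?thesis using assms unfolding P_def by blast
qed

subsection \<open>Multivariate normal distributions\<close>

text \<open>Gram-Schmidt for the inner product \<open>x \<bullet> (S *v y)\<close>, by induction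
  over finite sets of indices so that the final family is indexed by the coordinates
  themselves.\<close>

lemma sym_posdef_orthonormal:
  fixes S :: "real^'d^'d"
  assumes S: "sym_posdef S"
  shows "\<exists>b :: 'd \<Rightarrow> real^'d. \<forall>i j. b i \<bullet> (S *v b j) = (if i = j then 1 else 0)"
proof -
  have sym: "x \<bullet> (S *v y) = y \<bullet> (S *v x)" for x y
    using S unfolding sym_posdef_def by (metis dot_lmul_matrix inner_commute transpose_matrix_vector)
  have pos: "x \<bullet> (S *v x) > 0" if "x \<noteq> 0" for x
    using S that by (simp add: sym_posdef_def)
  have "\<exists>b :: 'd \<Rightarrow> real^'d. \<forall>i\<in>I. \<forall>j\<in>I. b i \<bullet> (S *v b j) = (if i = j then 1 else 0)"
    if "finite I" for I :: "'d set"
    using that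
  proof (induction I rule: finite_induct)
    case empty then show ?case by simp
  next
    case (insert k I)
    then obtain b :: "'d \<Rightarrow> real^'d"
      where b: "\<And>i j. i \<in> I \<Longrightarrow> j \<in> I \<Longrightarrow> b i \<bullet> (S *v b j) = (if i = j then 1 else 0)"
      by blast
    \<comment> \<open>The vectors \<open>S *v b i\<close> are too few to span the space. A nonzero
      vector orthogonal to all of them is orthogonal to every \<open>b i\<close> in the inner
      product of \<open>S\<close>, and only needs rescaling.\<close>
    have "dim ((\<lambda>i. S *v b i) ` I) \<le> card I"
      using insert.hyps by (meson card_image_le dim_le_card' finite_imageI le_trans)
    also have "\<dots> < DIM(real^'d)"
      using insert.hyps psubset_card_mono[of UNIV I] by auto
    finally obtain x where x: "x \<noteq> 0" "\<And>y. y \<in> span ((\<lambda>i. S *v b i) ` I) \<Longrightarrow> orthogonal x y"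
      by (rule orthogonal_to_subspace_exists) blast
    define y where "y = (1 / sqrt (x \<bullet> (S *v x))) *\<^sub>R x"
    have "y \<bullet> (S *v y) = 1"
      using pos[OF x(1)] by (simp add: y_def matrix_vector_mult_scaleR)
    moreover have orth: "y \<bullet> (S *v b i) = 0" if "i \<in> I" for i
      using x(2)[of "S *v b i"] that by (simp add: y_def orthogonal_def span_base)
    moreover have "b i \<bullet> (S *v y) = 0" if "i \<in> I" for i
      using orth[OF that] sym by simp
    ultimately show ?case
      using b insert.hyps by (intro exI[of _ "b(k := y)"]) auto
  qed
  from this[of UNIV] show ?thesis by simp
qed

text \<open>If the columns of \<open>B\<close> are orthonormal for \<open>S\<close>, then
  \<open>transpose B ** S ** B\<close> is the identity. Hence \<open>A = S ** B\<close> pulls the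
  form of the inverse of \<open>S\<close> back to the standard inner product, and taking
  determinants gives the square. \<open>A\<close> serves as a square root of the covariance.\<close>

lemma sym_posdef_factor:
  fixes S :: "real^'d^'d"
  assumes S: "sym_posdef S"
  obtains A :: "real^'d^'d" where "det A \<noteq> 0" "(det A)\<^sup>2 = det S"
    "\<And>x. (A *v x) \<bullet> (matrix_inv S *v (A *v x)) = x \<bullet> x"
proof -
  obtain b :: "'d \<Rightarrow> real^'d" where b: "\<And>i j. b i \<bullet> (S *v b j) = (if i = j then 1 else 0)"
    using sym_posdef_orthonormal[OF S] by blast
  define B :: "real^'d^'d" where "B = transpose (\<chi> i. b i)"
  have col: "column j B = b j" for j
    by (simp add: B_def column_def transpose_def vec_eq_iff)
  have 1: "transpose B ** (S ** B) = mat 1"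
  proof -
    have "(transpose B ** (S ** B)) $ i $ j = (mat 1 :: real^'d^'d) $ i $ j" for i j
    proof -
      have "(transpose B ** (S ** B)) $ i $ j = b i \<bullet> (S *v b j)"
        by (simp add: matrix_matrix_mult_def matrix_vector_mult_def inner_vec_def transpose_def B_def)
      then show ?thesis by (simp add: b mat_def)
    qed
    then show ?thesis by (simp add: vec_eq_iff)
  qed
  then have d1: "det B * (det S * det B) = 1"
    by (metis det_I det_mul det_transpose)
  then have "det S \<noteq> 0" by auto
  then have inv: "matrix_inv S ** S = mat 1"
    unfolding matrix_inv_def
    by (metis (mono_tags, lifting) invertible_def invertible_det_nz someI_ex)
  show thesis
  proof (rule that[of "S ** B"])
    show "det (S ** B) \<noteq> 0" using d1 by (auto simp: det_mul)
    have "(det (S ** B))\<^sup>2 = det S * (det B * (det S * det B))"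
      by (simp add: det_mul power2_eq_square algebra_simps)
    then show "(det (S ** B))\<^sup>2 = det S" by (simp add: d1)
    fix x
    have "((S ** B) *v x) \<bullet> (matrix_inv S *v ((S ** B) *v x)) = ((S ** B) *v x) \<bullet> (B *v x)"
      by (metis inv matrix_mul_assoc matrix_mul_lid matrix_vector_mul_assoc)
    also have "\<dots> = x \<bullet> ((transpose B ** (S ** B)) *v x)"
      by (metis dot_lmul_matrix inner_commute matrix_vector_mul_assoc transpose_matrix_vector)
    finally show "((S ** B) *v x) \<bullet> (matrix_inv S *v ((S ** B) *v x)) = x \<bullet> x"
      by (simp add: 1)
  qed
qed

lemma borel_measurable_mvn_pdf [measurable]: "mvn_pdf m S \<in> borel_measurable borel"
proof -
  have [measurable]: "(\<lambda>x. matrix_inv S *v (x - m)) \<in> borel_measurable borel"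
    by (intro borel_measurable_continuous_onI continuous_intros
        matrix_vector_mult_linear_continuous_on[THEN continuous_on_compose2]) auto
  show ?thesis unfolding mvn_pdf_def[abs_def] by measurable
qed

text \<open>\<open>sqrt\<close> is negative at negative arguments, so the sign rests on
  \<open>det S\<close> being a square.\<close>

lemma mvn_pdf_nonneg:
  assumes "sym_posdef S" shows "0 \<le> mvn_pdf m S x"
proof -
  obtain A :: "real^'a^'a" where "(det A)\<^sup>2 = det S" using sym_posdef_factor[OF assms] by metis
  then have "0 \<le> det S" by (metis zero_le_power2)
  then show ?thesis by (simp add: mvn_pdf_def)
qed

text \<open>Substituting \<open>x = m + A *v u\<close> turns the quadratic form into
  \<open>u \<bullet> u\<close>, and the Jacobian \<open>\<bar>det A\<bar>\<close> cancels
  \<open>sqrt (det S)\<close> in the normalising constant. The remaining weight factors over the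
  coordinates, so total mass and first moment reduce to one-dimensional integrals.\<close>

lemma nn_integral_mvn_standardize:
  fixes S :: "real^'d^'d"
  assumes S: "sym_posdef S"
  shows "\<exists>A :: real^'d^'d. \<forall>m. \<forall>h\<in>borel_measurable borel. (\<integral>\<^sup>+x. h x \<partial>mvn m S) =
       (\<integral>\<^sup>+u. ennreal (\<Prod>b\<in>Basis. std_normal_density (u \<bullet> b)) * h (m + A *v u) \<partial>lborel)"
proof -
  obtain A :: "real^'d^'d" where det: "det A \<noteq> 0" "(det A)\<^sup>2 = det S"
    and A: "\<And>x. (A *v x) \<bullet> (matrix_inv S *v (A *v x)) = x \<bullet> x"
    by (rule sym_posdef_factor[OF S]) (rule that)
  have pdf: "\<bar>det A\<bar> * mvn_pdf m S (m + A *v u) = (\<Prod>b\<in>Basis. std_normal_density (u \<bullet> b))" for m u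
  proof -
    have "(\<Prod>b\<in>Basis. std_normal_density (u \<bullet> b))
        = (1 / sqrt (2 * pi)) ^ CARD('d) * exp (\<Sum>b\<in>Basis. - (u \<bullet> b)\<^sup>2 / 2)"
      by (simp only: std_normal_density_def prod.distrib prod_constant DIM_cart DIM_real exp_sum[OF finite_Basis]) simp
    also have "(\<Sum>b\<in>Basis. - (u \<bullet> b)\<^sup>2 / 2) = - (u \<bullet> u) / 2"
      by (subst euclidean_inner[of u u]) (simp add: sum_negf sum_divide_distrib power2_eq_square)
    also have "(1 / sqrt (2 * pi)) ^ CARD('d) = \<bar>det A\<bar> / sqrt ((2 * pi) ^ CARD('d) * det S)"
    proof -
      have "sqrt (det S) = \<bar>det A\<bar>" by (simp flip: det(2))
      then show ?thesis using det(1) by (simp add: real_sqrt_mult real_sqrt_power power_one_over power_mult_distrib)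
    qed
    finally show ?thesis by (simp add: mvn_pdf_def A)
  qed
  show ?thesis
  proof (intro exI[of _ A] allI ballI)
    fix m and h :: "real^'d \<Rightarrow> ennreal" assume [measurable]: "h \<in> borel_measurable borel"
    have "(\<integral>\<^sup>+x. h x \<partial>mvn m S) = (\<integral>\<^sup>+x. ennreal (mvn_pdf m S x) * h x \<partial>lborel)"
      by (simp add: mvn_def nn_integral_density)
    also have "\<dots> = (\<integral>\<^sup>+x. ennreal (mvn_pdf m S (x + m)) * h (x + m) \<partial>lborel)"
      by (rule nn_integral_lborel_add[symmetric]) measurable
    also have "\<dots> = ennreal \<bar>det A\<bar> * (\<integral>\<^sup>+u. ennreal (mvn_pdf m S (A *v u + m)) * h (A *v u + m) \<partial>lborel)"
      by (rule nn_integral_lborel_matrix[OF det(1)]) measurable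
    also have "\<dots> = (\<integral>\<^sup>+u. ennreal (\<Prod>b\<in>Basis. std_normal_density (u \<bullet> b)) * h (m + A *v u) \<partial>lborel)"
      unfolding pdf[of m, symmetric]
      by (subst nn_integral_cmult[symmetric]) (simp_all add: ennreal_mult' mult.assoc add.commute)
    finally show "(\<integral>\<^sup>+x. h x \<partial>mvn m S) =
       (\<integral>\<^sup>+u. ennreal (\<Prod>b\<in>Basis. std_normal_density (u \<bullet> b)) * h (m + A *v u) \<partial>lborel)" .
  qed
qed

lemma sets_mvn [simp, measurable_cong]: "sets (mvn m S) = sets borel"
  by (simp add: mvn_def)

lemma space_mvn [simp]: "space (mvn m S) = UNIV"
  by (simp add: mvn_def)

lemma prob_space_mvn:
  fixes S :: "real^'d^'d"
  assumes "sym_posdef S" shows "prob_space (mvn m S)"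
proof
  obtain A :: "real^'d^'d" where A: "\<forall>m. \<forall>h\<in>borel_measurable borel. (\<integral>\<^sup>+x. h x \<partial>mvn m S) =
       (\<integral>\<^sup>+u. ennreal (\<Prod>b\<in>Basis. std_normal_density (u \<bullet> b)) * h (m + A *v u) \<partial>lborel)"
    using nn_integral_mvn_standardize[OF assms] by blast
  have "emeasure (mvn m S) (space (mvn m S)) = (\<integral>\<^sup>+x. 1 \<partial>mvn m S)" by simp
  also have "\<dots> = (\<integral>\<^sup>+u. (\<Prod>b\<in>Basis. ennreal (std_normal_density (u \<bullet> b))) \<partial>(lborel :: (real^'d) measure))"
    by (subst A[rule_format]) (simp_all add: prod_ennreal)
  also have "\<dots> = 1"
    by (subst nn_integral_lborel_prod) (simp_all add: nn_integral_eq_integral)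
  finally show "emeasure (mvn m S) (space (mvn m S)) = 1" .
qed

lemma integrable_mvn_id:
  fixes S :: "real^'d^'d"
  assumes "sym_posdef S" shows "integrable (mvn m S) (\<lambda>x. x)"
proof (rule integrableI_bounded)
  interpret prob_space "mvn m S" by (rule prob_space_mvn[OF assms])
  obtain A :: "real^'d^'d" where A: "\<forall>m. \<forall>h\<in>borel_measurable borel. (\<integral>\<^sup>+x. h x \<partial>mvn m S) =
       (\<integral>\<^sup>+u. ennreal (\<Prod>b\<in>Basis. std_normal_density (u \<bullet> b)) * h (m + A *v u) \<partial>lborel)"
    using nn_integral_mvn_standardize[OF assms] by blast
  obtain K where K: "0 < K" "\<And>u. norm (A *v u) \<le> norm u * K"
    using bounded_linear.pos_bounded[OF matrix_vector_mul_bounded_linear[of A]] by auto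
  \<comment> \<open>A bound of product form keeps the integrand a product over the coordinates after
    standardisation.\<close>
  have norm_le: "norm u \<le> (\<Prod>b\<in>Basis. 1 + \<bar>u \<bullet> b\<bar>)" for u :: "real^'d"
  proof -
    have "norm u \<le> (\<Sum>b\<in>Basis. \<bar>u \<bullet> b\<bar>)" by (rule norm_le_l1)
    also have "\<dots> \<le> (\<Prod>b\<in>Basis. 1 + \<bar>u \<bullet> b\<bar>)" by (rule sum_le_prod) simp
    finally show ?thesis .
  qed
  have fin: "(\<integral>\<^sup>+u. (\<Prod>b\<in>Basis. ennreal (std_normal_density (u \<bullet> b) * (1 + \<bar>u \<bullet> b\<bar>))) \<partial>(lborel :: (real^'d) measure)) < \<infinity>"
  proof -
    \<comment> \<open>The standard normal density has finite absolute moments of orders 0 and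
      1.\<close>
    have "integrable lborel (\<lambda>x. std_normal_density x * (1 + \<bar>x\<bar>))"
      using integrable_normal_moment_abs[where \<mu>=0 and \<sigma>=1 and k=1]
      unfolding distrib_left mult_1_right by (intro Bochner_Integration.integrable_add) auto
    then have "(\<integral>\<^sup>+x. ennreal (std_normal_density x * (1 + \<bar>x\<bar>)) \<partial>lborel) < \<infinity>"
      by (subst nn_integral_eq_integral) auto
    then show ?thesis
      by (subst nn_integral_lborel_prod) (auto simp: power_less_top_ennreal)
  qed
  have "(\<integral>\<^sup>+x. norm x \<partial>mvn m S)
      = (\<integral>\<^sup>+u. ennreal (\<Prod>b\<in>Basis. std_normal_density (u \<bullet> b)) * ennreal (norm (m + A *v u)) \<partial>lborel)"
    by (rule A[rule_format]) measurable
  also have "\<dots> \<le> (\<integral>\<^sup>+u. ennreal (norm m + K) * (\<Prod>b\<in>Basis. ennreal (std_normal_density (u \<bullet> b) * (1 + \<bar>u \<bullet> b\<bar>)))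
      \<partial>(lborel :: (real^'d) measure))"
  proof (rule nn_integral_mono)
    fix u :: "real^'d"
    let ?p = "\<Prod>b\<in>Basis. std_normal_density (u \<bullet> b)" and ?q = "\<Prod>b\<in>Basis. 1 + \<bar>u \<bullet> b\<bar>"
    have "1 \<le> ?q" by (rule prod_ge_1) auto
    have "norm (m + A *v u) \<le> norm m + norm u * K"
      using norm_triangle_ineq[of m "A *v u"] K(2)[of u] by linarith
    also have "\<dots> \<le> norm m * ?q + ?q * K"
      using \<open>1 \<le> ?q\<close> norm_le[of u] K(1) by (intro add_mono mult_right_mono) (auto simp: mult_le_cancel_left1)
    finally have "?p * norm (m + A *v u) \<le> (norm m + K) * (?p * ?q)"
      by (metis (no_types, lifting) distrib_right mult.commute mult.left_commute mult_left_mono normal_density_nonneg prod_nonneg)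
    then show "ennreal ?p * ennreal (norm (m + A *v u))
        \<le> ennreal (norm m + K) * (\<Prod>b\<in>Basis. ennreal (std_normal_density (u \<bullet> b) * (1 + \<bar>u \<bullet> b\<bar>)))"
      using K(1) by (simp add: prod_ennreal prod_nonneg prod.distrib ennreal_mult[symmetric] ennreal_leI del: ennreal_plus)
  qed
  also have "\<dots> < \<infinity>"
    using fin by (subst nn_integral_cmult) (auto simp: ennreal_mult_less_top)
  finally show "(\<integral>\<^sup>+x. norm x \<partial>mvn m S) < \<infinity>" .
qed measurable

lemma ac_prob_mvn:
  assumes "sym_posdef S" shows "ac_prob (mvn m S)"
  unfolding ac_prob_def using prob_space_mvn[OF assms]
  by (auto simp: mvn_def intro!: absolutely_continuousI_density)

subsection \<open>Paths of the interpolant\<close>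

lemma sqrt_bridge_has_vector_derivative:
  fixes x y z :: "'a::real_normed_vector"
  assumes "0 < t" "t < 1"
  shows "((\<lambda>t. (1 - t) *\<^sub>R x + t *\<^sub>R y + sqrt (2 * t * (1 - t)) *\<^sub>R z) has_vector_derivative
     (y - x + ((1 - 2 * t) / sqrt (2 * t * (1 - t))) *\<^sub>R z)) (at t)"
proof -
  have pos: "2 * t * (1 - t) > 0" using assms by simp
  have "((\<lambda>t. sqrt (2 * t * (1 - t))) has_real_derivative (1 - 2 * t) / sqrt (2 * t * (1 - t))) (at t)"
  proof -
    have "((\<lambda>t. sqrt (2 * t * (1 - t))) has_real_derivative
        inverse (sqrt (2 * t * (1 - t))) / 2 * (2 - 4 * t)) (at t)"
      using pos
      by (intro DERIV_chain2[of sqrt, OF DERIV_real_sqrt]) (auto intro!: derivative_eq_intros)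
    also have "inverse (sqrt (2 * t * (1 - t))) / 2 * (2 - 4 * t) = (1 - 2 * t) / sqrt (2 * t * (1 - t))"
    proof -
      have "inverse s / 2 * (2 - 4 * t) = (1 - 2 * t) / s" for s :: real
        by (cases "s = 0") (auto simp: field_simps)
      then show ?thesis .
    qed
    finally show ?thesis .
  qed
  note s = this
  have "((\<lambda>t. (1 - t) *\<^sub>R x) has_vector_derivative (- x)) (at t)"
    "((\<lambda>t. t *\<^sub>R y) has_vector_derivative y) (at t)"
    by (auto intro!: derivative_eq_intros)
  from has_vector_derivative_add[OF has_vector_derivative_add[OF this] has_vector_derivative_scaleR[OF s has_vector_derivative_const]]
  show ?thesis by simp
qed

text \<open>The velocity is at most a constant times \<open>(t * (1 - t)) powr (- 1 / 2)\<close>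
  inside the interval. Its \<open>p\<close>-th power is thus dominated by a Beta integrand with both
  parameters \<open>1 - p / 2\<close>, positive because \<open>p < 2\<close>.\<close>

lemma integrable_sqrt_bridge_velocity_powr:
  fixes w z :: "'a::euclidean_space"
  assumes p: "1 \<le> p" "p < 2"
  shows "(\<lambda>t. norm (w + ((1 - 2 * t) / sqrt (2 * t * (1 - t))) *\<^sub>R z) powr p) integrable_on {0..1}"
proof -
  let ?g = "\<lambda>t. norm (w + ((1 - 2 * t) / sqrt (2 * t * (1 - t))) *\<^sub>R z) powr p"
  let ?C = "(norm w + norm z) powr p"
  \<comment> \<open>The summand 1 serves the endpoints: there the Beta integrand is 0, since
    \<open>0 powr a = 0\<close>, while division by zero reduces the velocity to
    \<open>w\<close>.\<close>
  let ?b = "\<lambda>t::real. ?C * (t powr (- p / 2) * (1 - t) powr (- p / 2) + 1)"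
  have "?g absolutely_integrable_on {0..1}"
  proof (rule measurable_bounded_by_integrable_imp_absolutely_integrable)
    show "?g \<in> borel_measurable (lebesgue_on {0..1})"
      by (intro measurable_restrict_space1 measurable_completion) measurable
    show "?b integrable_on {0..1}"
      using has_integral_Beta_real[of "1 - p / 2" "1 - p / 2"] p
      by (intro integrable_on_mult_right integrable_add) (auto simp: integrable_on_def)
    fix t :: real assume t: "t \<in> {0..1}"
    show "norm (?g t) \<le> ?b t"
    proof (cases "t = 0 \<or> t = 1")
      case True
      then have "?g t = norm w powr p" by auto
      also have "\<dots> \<le> ?C" using p by (intro powr_mono2) auto
      also have "\<dots> \<le> ?b t" by (simp add: mult_le_cancel_left1)
      finally show ?thesis by simp
    next
      case False
      then have t: "0 < t" "t < 1" using t by auto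
      define k where "k = 1 / sqrt (t * (1 - t))"
      let ?c = "(1 - 2 * t) / sqrt (2 * t * (1 - t))"
      have pos: "0 < t * (1 - t)" using t by simp
      have "t * (1 - t) \<le> 1" using t mult_le_one[of t "1 - t"] by simp
      then have "1 \<le> k" using pos by (simp add: k_def)
      \<comment> \<open>Dropping the factor 2 under the root shrinks the denominator, and the
        numerator satisfies \<open>\<bar>1 - 2 * t\<bar> \<le> 1\<close>.\<close>
      have "sqrt (t * (1 - t)) \<le> sqrt (2 * t * (1 - t))" using pos by simp
      then have "\<bar>?c\<bar> \<le> k"
        unfolding k_def abs_divide using t pos by (intro frac_le) auto
      have "norm (w + ?c *\<^sub>R z) \<le> norm w + \<bar>?c\<bar> * norm z"
        using norm_triangle_ineq[of w "?c *\<^sub>R z"] by simp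
      also have "\<dots> \<le> k * norm w + k * norm z"
        using \<open>1 \<le> k\<close> \<open>\<bar>?c\<bar> \<le> k\<close> by (intro add_mono mult_right_mono) (auto simp: mult_le_cancel_right1)
      finally have "?g t \<le> (k * (norm w + norm z)) powr p"
        using p by (intro powr_mono2) (auto simp: distrib_left)
      also have "\<dots> = ?C * k powr p"
        using \<open>1 \<le> k\<close> by (simp add: powr_mult)
      also have "k powr p = t powr (- p / 2) * (1 - t) powr (- p / 2)"
      proof -
        have "k = (t * (1 - t)) powr (- 1 / 2)"
          using pos by (simp add: k_def powr_minus_divide powr_half_sqrt)
        then show ?thesis using t by (simp add: powr_powr powr_mult)
      qed
      also have "?C * (t powr (- p / 2) * (1 - t) powr (- p / 2)) \<le> ?b t"
        by (simp add: distrib_left)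
      finally show ?thesis by simp
    qed
  qed simp
  then show ?thesis by (simp add: absolutely_integrable_on_def)
qed
lemma W1p_sqrt_bridge:
  fixes x y z :: "'a::euclidean_space"
  assumes p: "1 \<le> p" "p < 2"
  shows "W1p p (\<lambda>t. (1 - t) *\<^sub>R x + t *\<^sub>R y + sqrt (2 * t * (1 - t)) *\<^sub>R z)"
proof -
  let ?F = "\<lambda>t. (1 - t) *\<^sub>R x + t *\<^sub>R y + sqrt (2 * t * (1 - t)) *\<^sub>R z"
  let ?g = "\<lambda>t. y - x + ((1 - 2 * t) / sqrt (2 * t * (1 - t))) *\<^sub>R z"
  \<comment> \<open>The velocity may blow up at 0 and 1, but the path is continuous there, so
    differentiability in the interior suffices.\<close>
  have ftc: "(?g has_integral (?F t - ?F 0)) {0..t}" if "t \<in> {0..1}" for t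
    using that
    by (intro fundamental_theorem_of_calculus_interior sqrt_bridge_has_vector_derivative continuous_intros) auto
  \<comment> \<open>The case of exponent 1 of the power bound gives integrability of the
    norm.\<close>
  have "?g absolutely_integrable_on {0..1}"
    using ftc[of 1] integrable_sqrt_bridge_velocity_powr[of 1 "y - x" z]
    by (intro absolutely_integrable_onI) (auto simp: integrable_on_def)
  moreover have "(\<lambda>t. norm (?g t) powr p) integrable_on {0..1}"
    by (rule integrable_sqrt_bridge_velocity_powr[OF p])
  moreover have "?F t = ?F 0 + integral {0..t} ?g" if "t \<in> {0..1}" for t
    using integral_unique[OF ftc[OF that]] by simp
  ultimately show ?thesis unfolding W1p_def by (intro exI[of _ ?g]) blast
qed

subsection \<open>The reflection symmetry\<close>

text \<open>For a fixed second component the first is negated and then translated, so Tonelli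
  reduces the claim to two invariances of Lebesgue measure on one factor.\<close>

lemma nn_integral_lborel_shear_fst:
  fixes f :: "'b::euclidean_space \<Rightarrow> 'a::euclidean_space" and h :: "'a \<times> 'b \<Rightarrow> ennreal"
  assumes [measurable]: "f \<in> borel_measurable borel" "h \<in> borel_measurable borel"
  shows "(\<integral>\<^sup>+\<omega>. h (- fst \<omega> + f (snd \<omega>), snd \<omega>) \<partial>lborel) = (\<integral>\<^sup>+\<omega>. h \<omega> \<partial>lborel)"
proof -
  have [measurable]: "h \<in> borel_measurable (lborel \<Otimes>\<^sub>M lborel)"
    by (simp add: lborel_prod)
  have "(\<integral>\<^sup>+\<omega>. h (- fst \<omega> + f (snd \<omega>), snd \<omega>) \<partial>lborel)
      = (\<integral>\<^sup>+w. \<integral>\<^sup>+x. h (- x + f w, w) \<partial>lborel \<partial>lborel)"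
    by (subst lborel_prod[symmetric], subst lborel_pair.nn_integral_snd[symmetric]) simp_all
  also have "\<dots> = (\<integral>\<^sup>+w. \<integral>\<^sup>+x. h (x, w) \<partial>lborel \<partial>lborel)"
  proof (rule nn_integral_cong)
    fix w :: 'b
    have "(\<integral>\<^sup>+x. h (- x + f w, w) \<partial>lborel) = (\<integral>\<^sup>+x. h (x + f w, w) \<partial>lborel)"
      by (rule nn_integral_lborel_uminus[where h="\<lambda>x. h (x + f w, w)"]) measurable
    also have "\<dots> = (\<integral>\<^sup>+x. h (x, w) \<partial>lborel)"
      by (rule nn_integral_lborel_add[where h="\<lambda>x. h (x, w)"]) measurable
    finally show "(\<integral>\<^sup>+x. h (- x + f w, w) \<partial>lborel) = (\<integral>\<^sup>+x. h (x, w) \<partial>lborel)" .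
  qed
  also have "\<dots> = (\<integral>\<^sup>+\<omega>. h \<omega> \<partial>lborel)"
    using lborel_pair.nn_integral_snd[of h] by (simp add: lborel_prod)
  finally show ?thesis .
qed

lemma nn_integral_lborel_shear_snd:
  fixes g :: "'a::euclidean_space \<Rightarrow> 'b::euclidean_space" and h :: "'a \<times> 'b \<Rightarrow> ennreal"
  assumes [measurable]: "g \<in> borel_measurable borel" "h \<in> borel_measurable borel"
  shows "(\<integral>\<^sup>+\<omega>. h (fst \<omega>, snd \<omega> + g (fst \<omega>)) \<partial>lborel) = (\<integral>\<^sup>+\<omega>. h \<omega> \<partial>lborel)"
proof -
  have [measurable]: "h \<in> borel_measurable (lborel \<Otimes>\<^sub>M lborel)"
    by (simp add: lborel_prod)
  have "(\<integral>\<^sup>+\<omega>. h (fst \<omega>, snd \<omega> + g (fst \<omega>)) \<partial>lborel)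
      = (\<integral>\<^sup>+x. \<integral>\<^sup>+w. h (x, w + g x) \<partial>lborel \<partial>lborel)"
    by (subst lborel_prod[symmetric], subst lborel.nn_integral_fst[symmetric]) simp_all
  also have "\<dots> = (\<integral>\<^sup>+x. \<integral>\<^sup>+w. h (x, w) \<partial>lborel \<partial>lborel)"
    by (intro nn_integral_cong nn_integral_lborel_add[where h="\<lambda>w. h (x, w)" for x]) measurable
  also have "\<dots> = (\<integral>\<^sup>+\<omega>. h \<omega> \<partial>lborel)"
    using lborel.nn_integral_fst[of h lborel] by (simp add: lborel_prod)
  finally show ?thesis .
qed

text \<open>The component, not normalised, of the triple centred at \<open>(a, b, 0)\<close> along
  the normal \<open>(-1, 1, e)\<close>. For the \<open>e\<close> belonging to time \<open>t\<close>
  it is the velocity minus its mean \<open>b - a\<close>.\<close>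

definition offset :: "real \<Rightarrow> 'a \<Rightarrow> 'a \<Rightarrow> 'a \<times> 'a \<times> 'a \<Rightarrow> 'a::real_vector" where
  "offset e a b \<omega> = (case \<omega> of (x, y, z) \<Rightarrow> - (x - a) + (y - b) + e *\<^sub>R z)"

text \<open>The Householder reflection about the centre \<open>(a, b, 0)\<close> along
  \<open>(-1, 1, e)\<close>, whose squared length is \<open>2 + e\<^sup>2\<close>.\<close>

definition reflect :: "real \<Rightarrow> 'a \<Rightarrow> 'a \<Rightarrow> 'a \<times> 'a \<times> 'a \<Rightarrow> 'a \<times> 'a \<times> 'a::real_vector" where
  "reflect e a b \<omega> = (case \<omega> of (x, y, z) \<Rightarrow>
     let s = (2 / (2 + e\<^sup>2)) *\<^sub>R offset e a b \<omega> in (x + s, y - s, z - e *\<^sub>R s))"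

lemma reflect_coefficient: "2 / (2 + e\<^sup>2) * (2 + e\<^sup>2) = (2 :: real)"
proof -
  have "2 + e\<^sup>2 \<noteq> 0" by (metis add_pos_nonneg less_irrefl zero_le_power2 zero_less_numeral)
  then show ?thesis using nonzero_eq_divide_eq[of "2 + e\<^sup>2" "2 / (2 + e\<^sup>2)" 2] by blast
qed

lemma offset_reflect: "offset e a b (reflect e a b \<omega>) = - offset e a b \<omega>"
proof -
  obtain x y z where \<omega>: "\<omega> = (x, y, z)" by (cases \<omega>)
  let ?s = "offset e a b \<omega>" and ?k = "2 / (2 + e\<^sup>2)"
  have "offset e a b (x + s, y - s, z - e *\<^sub>R s) = offset e a b (x, y, z) - (2 + e\<^sup>2) *\<^sub>R s" for s
    by (simp add: offset_def algebra_simps power2_eq_square scaleR_2)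
  from this[of "?k *\<^sub>R ?s"] have "offset e a b (reflect e a b \<omega>) = ?s - (?k * (2 + e\<^sup>2)) *\<^sub>R ?s"
    by (simp only: \<omega> reflect_def Let_def prod.case scaleR_scaleR mult.commute[of ?k "2 + e\<^sup>2"])
  then show ?thesis unfolding reflect_coefficient by (simp add: scaleR_2)
qed

lemma borel_measurable_offset [measurable]:
  "offset e a b \<in> borel_measurable (borel :: ('a::euclidean_space \<times> 'a \<times> 'a) measure)"
  unfolding offset_def[abs_def] split_beta by (intro borel_measurable_continuous_onI continuous_intros)

lemma borel_measurable_reflect [measurable]:
  "reflect e a b \<in> borel_measurable (borel :: ('a::euclidean_space \<times> 'a \<times> 'a) measure)"
  unfolding reflect_def[abs_def] offset_def[abs_def] split_beta Let_def
  by (intro borel_measurable_continuous_onI continuous_intros)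

text \<open>In the coordinates \<open>(x, y + x, z + e x)\<close>, the last two of which are fixed by the reflection,
  it only acts on \<open>x\<close>.\<close>
lemma nn_integral_lborel_reflect:
  fixes h :: "'a::euclidean_space \<times> 'a \<times> 'a \<Rightarrow> ennreal"
  assumes [measurable]: "h \<in> borel_measurable borel"
  shows "(\<integral>\<^sup>+\<omega>. h (reflect e a b \<omega>) \<partial>lborel) = (\<integral>\<^sup>+\<omega>. h \<omega> \<partial>lborel)"
proof -
  let ?k = "2 / (2 + e\<^sup>2)"
  define f :: "'a \<times> 'a \<Rightarrow> 'a" where "f w = ?k *\<^sub>R (fst w + e *\<^sub>R snd w + a - b)" for w
  define g :: "'a \<Rightarrow> 'a \<times> 'a" where "g x = (x, e *\<^sub>R x)" for x
  \<comment> \<open>\<open>h1\<close> undoes the change of coordinates by \<open>g\<close>.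
    \<open>h2\<close> first applies the reflection in the new coordinates, which is
    \<open>x \<mapsto> - x + f w\<close> with \<open>w\<close> fixed.\<close>
  define h1 where "h1 \<omega> = h (fst \<omega>, snd \<omega> + - g (fst \<omega>))" for \<omega>
  define h2 where "h2 \<omega> = h1 (- fst \<omega> + f (snd \<omega>), snd \<omega>)" for \<omega>
  have [measurable]: "f \<in> borel_measurable borel" "g \<in> borel_measurable borel"
    unfolding f_def g_def by (intro borel_measurable_continuous_onI continuous_intros)+
  have [measurable]: "h1 \<in> borel_measurable borel"
    unfolding h1_def
    by (rule measurable_compose[OF _ assms])
      (auto intro!: borel_measurable_continuous_onI continuous_intros simp: g_def)
  have [measurable]: "h2 \<in> borel_measurable borel"
    unfolding h2_def
    by (rule measurable_compose[OF _ \<open>h1 \<in> borel_measurable borel\<close>])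
      (auto intro!: borel_measurable_continuous_onI continuous_intros simp: f_def)
  have "h (reflect e a b \<omega>) = h2 (fst \<omega>, snd \<omega> + g (fst \<omega>))" for \<omega>
  proof -
    obtain x y z where \<omega>: "\<omega> = (x, y, z)" by (cases \<omega>)
    define s where "s = ?k *\<^sub>R offset e a b \<omega>"
    \<comment> \<open>The displacement is rewritten through the fixed coordinates
      \<open>y + x\<close> and \<open>z + e x\<close>; what is left of \<open>x\<close> has
      coefficient \<open>?k * (2 + e\<^sup>2) = 2\<close>, turning \<open>x + s\<close> into
      \<open>- x + f w\<close>.\<close>
    have "s = ?k *\<^sub>R ((y + x) + e *\<^sub>R (z + e *\<^sub>R x) + a - b) - (?k * (2 + e\<^sup>2)) *\<^sub>R x"
      unfolding s_def scaleR_scaleR[symmetric] scaleR_diff_right[symmetric]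
      by (simp add: \<omega> offset_def algebra_simps power2_eq_square scaleR_2)
    then have s: "s = f (y + x, z + e *\<^sub>R x) - 2 *\<^sub>R x"
      by (simp only: reflect_coefficient f_def fst_conv snd_conv)
    have "reflect e a b \<omega> = (x + s, y - s, z - e *\<^sub>R s)"
      by (simp only: reflect_def \<omega> s_def Let_def prod.case)
    then show ?thesis
      unfolding s by (simp add: \<omega> h2_def h1_def g_def algebra_simps scaleR_2)
  qed
  then have "(\<integral>\<^sup>+\<omega>. h (reflect e a b \<omega>) \<partial>lborel) = (\<integral>\<^sup>+\<omega>. h2 \<omega> \<partial>lborel)"
    by (simp add: nn_integral_lborel_shear_snd)
  also have "\<dots> = (\<integral>\<^sup>+\<omega>. h1 \<omega> \<partial>lborel)"
    unfolding h2_def by (rule nn_integral_lborel_shear_fst) measurable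
  also have "\<dots> = (\<integral>\<^sup>+\<omega>. h \<omega> \<partial>lborel)"
    unfolding h1_def by (rule nn_integral_lborel_shear_snd[where g="\<lambda>x. - g x"]) measurable
  finally show ?thesis .
qed

text \<open>The same matrix acts on all three components, so a reflection that mixes the components
  with scalar coefficients preserves the sum of the forms. Concretely, the two cross terms each
  contribute \<open>- k\<close> times the form at \<open>s\<close>, and the square term contributes
  \<open>k * (k * (2 + e\<^sup>2)) = 2 * k\<close> times it.\<close>

lemma quadratic_form_reflect:
  fixes M :: "real^'d^'d"
  assumes "reflect e a b (x, y, z) = (x', y', z')"
  shows "(x' - a) \<bullet> (M *v (x' - a)) + (y' - b) \<bullet> (M *v (y' - b)) + z' \<bullet> (M *v z')
       = (x - a) \<bullet> (M *v (x - a)) + (y - b) \<bullet> (M *v (y - b)) + z \<bullet> (M *v z)"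
proof -
  define s where "s = offset e a b (x, y, z)"
  define k where "k = 2 / (2 + e\<^sup>2)"
  define \<xi> \<eta> where "\<xi> = x - a" and "\<eta> = y - b"
  have eqs: "x' - a = \<xi> + k *\<^sub>R s" "y' - b = \<eta> - k *\<^sub>R s" "z' = z - (e * k) *\<^sub>R s"
    using assms by (auto simp: reflect_def Let_def s_def k_def \<xi>_def \<eta>_def)
  have s: "s = \<eta> - \<xi> + e *\<^sub>R z" by (simp add: s_def offset_def \<xi>_def \<eta>_def)
  let ?B = "\<lambda>u v. u \<bullet> (M *v v)"
  \<comment> \<open>The offset is expanded once in each argument, to match the two cross terms
    separately.\<close>
  have 1: "?B s s = - ?B \<xi> s + ?B \<eta> s + e * ?B z s"
    by (subst (1) s) (simp add: inner_simps)
  have 2: "?B s s = - ?B s \<xi> + ?B s \<eta> + e * ?B s z"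
    by (subst (2) s) (simp add: inner_simps matrix_vector_right_distrib matrix_vector_mult_scaleR
      matrix_vector_mult_diff_distrib)
  have k: "k * (2 + e\<^sup>2) = 2" unfolding k_def by (rule reflect_coefficient)
  have "?B (\<xi> + k *\<^sub>R s) (\<xi> + k *\<^sub>R s) + ?B (\<eta> - k *\<^sub>R s) (\<eta> - k *\<^sub>R s) + ?B (z - (e * k) *\<^sub>R s) (z - (e * k) *\<^sub>R s)
      = ?B \<xi> \<xi> + ?B \<eta> \<eta> + ?B z z - k * (- ?B \<xi> s + ?B \<eta> s + e * ?B z s) - k * (- ?B s \<xi> + ?B s \<eta> + e * ?B s z)
        + k * (k * (2 + e\<^sup>2)) * ?B s s"
    by (simp add: matrix_vector_right_distrib matrix_vector_mult_diff_distrib matrix_vector_mult_scaleR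
        inner_simps algebra_simps power2_eq_square)
  also have "\<dots> = ?B \<xi> \<xi> + ?B \<eta> \<eta> + ?B z z"
    unfolding 1[symmetric] 2[symmetric] k by (simp add: algebra_simps)
  finally show ?thesis unfolding eqs by (simp add: \<xi>_def \<eta>_def)
qed

section \<open>The joint Gaussian law and its invariance under the reflection\<close>

lemma mvn_triple_density:
  fixes S :: "real^'d^'d"
  assumes S: "sym_posdef S"
  shows "mvn a S \<Otimes>\<^sub>M (mvn b S \<Otimes>\<^sub>M mvn 0 S)
    = density lborel (\<lambda>(x, y, z). ennreal (mvn_pdf a S x) * (ennreal (mvn_pdf b S y) * ennreal (mvn_pdf 0 S z)))"
proof -
  have sf: "sigma_finite_measure (mvn m S)" for m
    using prob_space_mvn[OF S] prob_space_imp_sigma_finite by blast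
  have "mvn b S \<Otimes>\<^sub>M mvn 0 S = density lborel (\<lambda>(y, z). ennreal (mvn_pdf b S y) * ennreal (mvn_pdf 0 S z))"
    unfolding mvn_def
    by (subst pair_measure_density) (simp_all add: lborel_prod sigma_finite_lborel sf[unfolded mvn_def])
  moreover have "sigma_finite_measure (mvn b S \<Otimes>\<^sub>M mvn 0 S)"
    using prob_space_mvn[OF S] prob_space_pair prob_space_imp_sigma_finite by blast
  ultimately show ?thesis
    unfolding mvn_def[of a] \<open>mvn b S \<Otimes>\<^sub>M mvn 0 S = _\<close>
    by (subst pair_measure_density)
      (simp_all add: lborel_prod sigma_finite_lborel split_beta' borel_prod[symmetric])
qed

text \<open>The joint density depends only on the sum of the three quadratic forms, which the
  reflection preserves, and Lebesgue measure is invariant as well.\<close>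

lemma distr_mvn_triple_reflect:
  fixes S :: "real^'d^'d" and a b :: "real^'d"
  assumes S: "sym_posdef S"
  defines "M \<equiv> mvn a S \<Otimes>\<^sub>M (mvn b S \<Otimes>\<^sub>M mvn 0 S)"
  shows "distr M M (reflect e a b) = M"
proof -
  define p where "p \<omega> = (case \<omega> of (x, y, z) \<Rightarrow>
    ennreal (mvn_pdf a S x) * (ennreal (mvn_pdf b S y) * ennreal (mvn_pdf 0 S z)))" for \<omega>
  have [measurable]: "p \<in> borel_measurable borel"
    unfolding p_def split_beta' borel_prod[symmetric] by measurable
  have M: "M = density lborel p"
    unfolding M_def p_def by (rule mvn_triple_density[OF S])
  have p_reflect: "p (reflect e a b \<omega>) = p \<omega>" for \<omega>
  proof -
    obtain x y z where \<omega>: "\<omega> = (x, y, z)" by (cases \<omega>)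
    obtain x' y' z' where r: "reflect e a b (x, y, z) = (x', y', z')" by (cases "reflect e a b (x, y, z)")
    define D where "D = sqrt ((2 * pi) ^ CARD('d) * det S)"
    let ?q = "\<lambda>v. v \<bullet> (matrix_inv S *v v)"
    have pdf: "mvn_pdf m S x = exp (- ?q (x - m) / 2) / D" for m x
      by (simp add: mvn_pdf_def D_def)
    \<comment> \<open>The common covariance lets the three exponents merge into one sum, with the
      same constant \<open>D\<close> three times in the denominator.\<close>
    have p: "p (x, y, z) = ennreal (exp (- (?q (x - a) + ?q (y - b) + ?q z) / 2) / D ^ 3)" for x y z
    proof -
      have "exp (- (?q (x - a) + ?q (y - b) + ?q z) / 2)
          = exp (- ?q (x - a) / 2) * (exp (- ?q (y - b) / 2) * exp (- ?q z / 2))"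
        by (simp add: add_divide_distrib flip: exp_add)
      then have "exp (- (?q (x - a) + ?q (y - b) + ?q z) / 2) / D ^ 3
          = mvn_pdf a S x * (mvn_pdf b S y * mvn_pdf 0 S z)"
        unfolding pdf diff_zero by (simp only: power3_eq_cube times_divide_times_eq mult.assoc)
      then show ?thesis
        using mvn_pdf_nonneg[OF S] by (simp add: p_def ennreal_mult)
    qed
    show ?thesis unfolding \<omega> r p quadratic_form_reflect[OF r] ..
  qed
  show ?thesis
  proof (rule measure_eqI)
    fix A assume "A \<in> sets (distr M M (reflect e a b))"
    then have [measurable]: "A \<in> sets borel" by (simp add: M)
    have "emeasure (distr M M (reflect e a b)) A = (\<integral>\<^sup>+\<omega>. indicator A \<omega> \<partial>distr M M (reflect e a b))"
      by (simp add: M)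
    also have "\<dots> = (\<integral>\<^sup>+\<omega>. indicator A (reflect e a b \<omega>) \<partial>M)"
      by (rule nn_integral_distr) (simp_all add: M)
    also have "\<dots> = (\<integral>\<^sup>+\<omega>. p \<omega> * indicator A (reflect e a b \<omega>) \<partial>lborel)"
      unfolding M by (rule nn_integral_density) measurable
    also have "\<dots> = (\<integral>\<^sup>+\<omega>. p (reflect e a b \<omega>) * indicator A (reflect e a b \<omega>) \<partial>lborel)"
      by (simp add: p_reflect)
    also have "\<dots> = (\<integral>\<^sup>+\<omega>. p \<omega> * indicator A \<omega> \<partial>lborel)"
      by (rule nn_integral_lborel_reflect) measurable
    also have "\<dots> = emeasure M A" by (simp add: M emeasure_density)
    finally show "emeasure (distr M M (reflect e a b)) A = emeasure M A" .
  qed simp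
qed

text \<open>The displacement is along \<open>(-1, 1, e)\<close>, orthogonal to the coefficients
  \<open>(1 - t, t, c)\<close>: indeed \<open>- (1 - t) + t + e * c = 0\<close>.\<close>

lemma bridge_reflect:
  fixes c e t :: real
  assumes "e * c = 1 - 2 * t"
  defines "X \<equiv> \<lambda>(x, y, z). (1 - t) *\<^sub>R x + t *\<^sub>R y + c *\<^sub>R (z :: 'a::real_vector)"
  shows "X (reflect e a b \<omega>) = X \<omega>"
proof -
  obtain x y z where \<omega>: "\<omega> = (x, y, z)" by (cases \<omega>)
  have "X (x + s, y - s, z - e *\<^sub>R s) = X (x, y, z) + (1 - t - t - e * c) *\<^sub>R s" for s
    by (simp add: X_def algebra_simps) (simp add: mult.commute flip: scaleR_2)
  moreover have "1 - t - t - e * c = 0" using assms(1) by simp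
  ultimately show ?thesis
    by (simp only: \<omega> reflect_def Let_def prod.case scaleR_zero_left add_0_right)
qed

section \<open>The centred velocity has conditional mean zero given the position\<close>

lemma integrable_pair_fst:
  fixes f :: "'a \<Rightarrow> 'c::{banach, second_countable_topology}"
  assumes "prob_space N" "integrable M f"
  shows "integrable (M \<Otimes>\<^sub>M N) (\<lambda>\<omega>. f (fst \<omega>))"
  using prob_space.distr_pair_fst[OF assms(1), of M] assms(2) integrable_distr_eq[of fst "M \<Otimes>\<^sub>M N" M f]
  by (metis borel_measurable_integrable measurable_fst)

lemma integrable_pair_snd:
  fixes f :: "'b \<Rightarrow> 'c::{banach, second_countable_topology}"
  assumes "prob_space M" "prob_space N" "integrable N f"
  shows "integrable (M \<Otimes>\<^sub>M N) (\<lambda>\<omega>. f (snd \<omega>))"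
proof -
  interpret pair_sigma_finite N M
    using assms(1,2) by (simp add: pair_sigma_finite.intro prob_space_imp_sigma_finite)
  show ?thesis
    using integrable_product_swap[OF integrable_pair_fst[OF assms(1,3)]] by (simp add: split_beta')
qed

text \<open>The offset inherits integrability from the first moments of the three components. The
  reflection fixes the position and hence the indicator, negates the offset and preserves the law,
  so the integral equals its own negative.\<close>

lemma
  fixes S :: "real^'d^'d" and a b :: "real^'d"
  assumes S: "sym_posdef S"
  defines "M \<equiv> mvn a S \<Otimes>\<^sub>M (mvn b S \<Otimes>\<^sub>M mvn 0 S)"
  shows integrable_offset: "integrable M (offset e a b)"
    and integral_indicator_offset:
      "A \<in> sets borel \<Longrightarrow> e * c = 1 - 2 * t \<Longrightarrow>
       (\<integral>\<omega>. indicator A (case \<omega> of (x, y, z) \<Rightarrow> (1 - t) *\<^sub>R x + t *\<^sub>R y + c *\<^sub>R z) *\<^sub>R offset e a b \<omega> \<partial>M) = 0"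
proof -
  have P: "prob_space (mvn m S)" for m by (rule prob_space_mvn[OF S])
  have P2: "prob_space (mvn b S \<Otimes>\<^sub>M mvn 0 S)" by (intro prob_space_pair P)
  interpret prob_space M unfolding M_def by (intro prob_space_pair P P2)
  have I: "integrable (mvn m S) (\<lambda>x. x)" for m by (rule integrable_mvn_id[OF S])
  have "integrable M (\<lambda>\<omega>. fst \<omega>)"
    unfolding M_def by (rule integrable_pair_fst[OF P2 I])
  moreover have "integrable M (\<lambda>\<omega>. fst (snd \<omega>))"
    unfolding M_def by (intro integrable_pair_snd integrable_pair_fst P P2 I)
  moreover have "integrable M (\<lambda>\<omega>. snd (snd \<omega>))"
    unfolding M_def by (intro integrable_pair_snd P P2 I)
  ultimately have "integrable M (\<lambda>\<omega>. - (fst \<omega> - a) + (fst (snd \<omega>) - b) + e *\<^sub>R snd (snd \<omega>))"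
    by (intro Bochner_Integration.integrable_add Bochner_Integration.integrable_diff
        Bochner_Integration.integrable_minus integrable_scaleR_right) auto
  then show int: "integrable M (offset e a b)"
    by (simp add: offset_def[abs_def] split_beta')
  assume [measurable]: "A \<in> sets borel" and ec: "e * c = 1 - 2 * t"
  have [simp, measurable_cong]: "sets M = sets borel"
    by (simp add: M_def mvn_triple_density[OF S])
  define X where "X = (\<lambda>(x, y, z). (1 - t) *\<^sub>R x + t *\<^sub>R y + c *\<^sub>R (z :: real^'d))"
  define G where "G \<omega> = indicator A (X \<omega>) *\<^sub>R offset e a b \<omega>" for \<omega>
  have [measurable]: "X \<in> borel_measurable borel"
    unfolding X_def split_beta' by (intro borel_measurable_continuous_onI continuous_intros)
  have [measurable]: "G \<in> borel_measurable borel" unfolding G_def by measurable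
  have "G (reflect e a b \<omega>) = - G \<omega>" for \<omega>
    using bridge_reflect[OF ec, of a b \<omega>] by (simp add: G_def X_def offset_reflect)
  then have "(\<integral>\<omega>. G \<omega> \<partial>distr M M (reflect e a b)) = - (\<integral>\<omega>. G \<omega> \<partial>M)"
    by (subst integral_distr) auto
  then have "(\<integral>\<omega>. G \<omega> \<partial>M) = - (\<integral>\<omega>. G \<omega> \<partial>M)"
    using distr_mvn_triple_reflect[OF S, of a b e] by (simp add: M_def)
  then have "2 *\<^sub>R (\<integral>\<omega>. G \<omega> \<partial>M) = 0" unfolding scaleR_2 eq_neg_iff_add_eq_0 .
  then have "(\<integral>\<omega>. G \<omega> \<partial>M) = 0" by simp
  then show "(\<integral>\<omega>. indicator A (case \<omega> of (x, y, z) \<Rightarrow> (1 - t) *\<^sub>R x + t *\<^sub>R y + c *\<^sub>R z) *\<^sub>R offset e a b \<omega> \<partial>M) = 0"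
    by (simp add: G_def X_def)
qed

subsection \<open>The conditional velocity\<close>

lemma base_path_sqrt_bridge:
  assumes "1 \<le> p" "p < 2"
  shows "base_path p (\<lambda>t (x :: 'a::euclidean_space) y z. (1 - t) *\<^sub>R x + t *\<^sub>R y + sqrt (2 * t * (1 - t)) *\<^sub>R z)"
proof -
  have "(\<lambda>(t, x, y, z). (1 - t) *\<^sub>R x + t *\<^sub>R y + sqrt (2 * t * (1 - t)) *\<^sub>R z)
      \<in> borel_measurable (borel :: (real \<times> 'a \<times> 'a \<times> 'a) measure)"
    unfolding split_beta' by (intro borel_measurable_continuous_onI continuous_intros)
  then show ?thesis
    unfolding base_path_def
    by (intro conjI measurable_restrict_space1 AE_I2) (auto simp: W1p_sqrt_bridge[OF assms])
qed

text \<open>The projection is the product map of the identity and \<open>fst\<close>, so its law is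
  the product of the image laws; \<open>Q\<close> integrates out with mass 1.\<close>

lemma distr_pair_marginals:
  assumes "prob_space P" "prob_space P'" "prob_space Q"
    and [measurable_cong]: "sets P = sets borel" "sets P' = sets borel"
  shows "distr (P \<Otimes>\<^sub>M (P' \<Otimes>\<^sub>M Q)) (borel \<Otimes>\<^sub>M borel) (\<lambda>\<omega>. (fst \<omega>, fst (snd \<omega>))) = P \<Otimes>\<^sub>M P'"
proof -
  have 1: "distr P borel (\<lambda>x. x) = P"
    using assms(4) by (simp add: distr_id2)
  have "distr (P' \<Otimes>\<^sub>M Q) borel fst = distr (P' \<Otimes>\<^sub>M Q) P' fst"
    using assms(5) by (intro distr_cong) simp_all
  then have 2: "distr (P' \<Otimes>\<^sub>M Q) borel fst = P'"
    using prob_space.distr_pair_fst[OF assms(3), of P'] by simp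
  have "distr P borel (\<lambda>x. x) \<Otimes>\<^sub>M distr (P' \<Otimes>\<^sub>M Q) borel fst
      = distr (P \<Otimes>\<^sub>M (P' \<Otimes>\<^sub>M Q)) (borel \<Otimes>\<^sub>M borel) (\<lambda>(x, y). (x, fst y))"
    using assms by (intro pair_measure_distr) (auto simp: 2 intro: prob_space_imp_sigma_finite)
  then show ?thesis by (simp add: 1 2 split_beta')
qed

text \<open>The velocity splits as \<open>offset e m0 m1\<close> plus the constant
  \<open>m1 - m0\<close>. The offset integrates to zero over every event determined by the position,
  which leaves the constant.\<close>

lemma is_cond_velocity_sqrt_bridge:
  fixes S :: "real^'d^'d"
  assumes S: "sym_posdef S"
  defines "F \<equiv> \<lambda>t x y z. (1 - t) *\<^sub>R x + t *\<^sub>R y + sqrt (2 * t * (1 - t)) *\<^sub>R z"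
  shows "is_cond_velocity (induced_space (mvn m0 S) (mvn m1 S) (mvn 0 S)) (induced_process F)
    (\<lambda>t x. m1 - m0)"
proof -
  define M where "M = mvn m0 S \<Otimes>\<^sub>M (mvn m1 S \<Otimes>\<^sub>M mvn 0 S)"
  interpret prob_space M
    unfolding M_def by (intro prob_space_pair prob_space_mvn[OF S])
  have [simp, measurable_cong]: "sets M = sets borel"
    by (simp add: M_def mvn_triple_density[OF S])
  have main: "(AE \<omega> in M. (\<lambda>s. induced_process F s \<omega>) differentiable (at t))
      \<and> integrable M (\<lambda>\<omega>. vector_derivative (\<lambda>s. induced_process F s \<omega>) (at t))
      \<and> integrable M (\<lambda>\<omega>. m1 - m0)
      \<and> (\<forall>A\<in>sets borel.
           (\<integral>\<omega>. indicator A (induced_process F t \<omega>) *\<^sub>R vector_derivative (\<lambda>s. induced_process F s \<omega>) (at t) \<partial>M)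
         = (\<integral>\<omega>. indicator A (induced_process F t \<omega>) *\<^sub>R (m1 - m0) \<partial>M))"
    if "t \<in> {0<..<1}" for t
  proof -
    define c where "c = sqrt (2 * t * (1 - t))"
    define e where "e = (1 - 2 * t) / c"
    \<comment> \<open>Strict interiority of \<open>t\<close> keeps \<open>e\<close> from being a
      division by zero, so the orthogonality relation holds.\<close>
    have "c > 0" using that by (simp add: c_def)
    then have ec: "e * c = 1 - 2 * t" by (simp add: e_def)
    have deriv: "((\<lambda>s. induced_process F s \<omega>) has_vector_derivative (offset e m0 m1 \<omega> + (m1 - m0))) (at t)"
      for \<omega>
    proof -
      obtain x y z where \<omega>: "\<omega> = (x, y, z)" by (cases \<omega>)
      have "offset e m0 m1 \<omega> + (m1 - m0) = y - x + e *\<^sub>R z"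
        by (simp add: \<omega> offset_def)
      then show ?thesis
        using sqrt_bridge_has_vector_derivative[of t x y z] that
        by (simp add: \<omega> induced_process_def F_def e_def c_def)
    qed
    note vd = vector_derivative_at[OF deriv]
    have X: "induced_process F t = (\<lambda>(x, y, z). (1 - t) *\<^sub>R x + t *\<^sub>R y + c *\<^sub>R z)"
      by (simp add: fun_eq_iff induced_process_def F_def c_def)
    have [measurable]: "induced_process F t \<in> borel_measurable borel"
      unfolding X split_beta' by (intro borel_measurable_continuous_onI continuous_intros)
    have int: "integrable M (offset e m0 m1)"
      unfolding M_def by (rule integrable_offset[OF S])
    have "(\<integral>\<omega>. indicator A (induced_process F t \<omega>) *\<^sub>R (offset e m0 m1 \<omega> + (m1 - m0)) \<partial>M)
         = (\<integral>\<omega>. indicator A (induced_process F t \<omega>) *\<^sub>R (m1 - m0) \<partial>M)"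
      if [measurable]: "A \<in> sets borel" for A
    proof -
      have "(\<integral>\<omega>. indicator A (induced_process F t \<omega>) *\<^sub>R (offset e m0 m1 \<omega> + (m1 - m0)) \<partial>M)
         = (\<integral>\<omega>. indicator A (induced_process F t \<omega>) *\<^sub>R offset e m0 m1 \<omega> \<partial>M)
           + (\<integral>\<omega>. indicator A (induced_process F t \<omega>) *\<^sub>R (m1 - m0) \<partial>M)"
        unfolding scaleR_add_right
      proof (rule Bochner_Integration.integral_add)
        \<comment> \<open>The indicator is at most 1, so the offset itself dominates.\<close>
        show "integrable M (\<lambda>\<omega>. indicator A (induced_process F t \<omega>) *\<^sub>R offset e m0 m1 \<omega>)"
          by (rule Bochner_Integration.integrable_bound[OF int])
            (measurable, auto simp: indicator_def)
        show "integrable M (\<lambda>\<omega>. indicator A (induced_process F t \<omega>) *\<^sub>R (m1 - m0))"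
          by (rule integrable_const_bound[of _ "norm (m1 - m0)"]) (auto simp: indicator_def)
      qed
      also have "(\<integral>\<omega>. indicator A (induced_process F t \<omega>) *\<^sub>R offset e m0 m1 \<omega> \<partial>M) = 0"
        unfolding X M_def by (rule integral_indicator_offset[OF S that ec])
      finally show ?thesis by simp
    qed
    moreover have "AE \<omega> in M. (\<lambda>s. induced_process F s \<omega>) differentiable (at t)"
      by (intro AE_I2 differentiableI_vector[OF deriv])
    ultimately show ?thesis
      using int by (simp add: vd)
  qed
  show ?thesis
    unfolding is_cond_velocity_def induced_space_def M_def[symmetric]
    using main by auto
qed

theorem theorem3p1:
  fixes p :: real and m0 m1 :: "real^'d" and \<Sigma> :: "real^'d^'d"
  assumes "1 \<le> p" and "p < 2"
    and "sym_posdef \<Sigma>"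
  shows "in_F_SL p (\<lambda>t x y z. (1 - t) *\<^sub>R x + t *\<^sub>R y + sqrt (2 * t * (1 - t)) *\<^sub>R z)
           (mvn 0 \<Sigma>) (mvn m0 \<Sigma>) (mvn m1 \<Sigma>)"
proof -
  let ?F = "\<lambda>t x y z. (1 - t) *\<^sub>R x + t *\<^sub>R y + sqrt (2 * t * (1 - t)) *\<^sub>R (z :: real^'d)"
  let ?M = "induced_space (mvn m0 \<Sigma>) (mvn m1 \<Sigma>) (mvn 0 \<Sigma>)"
  note P = prob_space_mvn[OF assms(3)]
  have sets: "sets ?M = sets borel"
    by (simp add: induced_space_def mvn_triple_density[OF assms(3)])
  have "in_S ?M (induced_process ?F) (mvn m0 \<Sigma>) (mvn m1 \<Sigma>)"
    unfolding in_S_def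
  proof (intro conjI ballI AE_I2)
    show "prob_space ?M"
      unfolding induced_space_def by (intro prob_space_pair P)
    show "induced_process ?F t \<in> borel_measurable ?M" for t
      unfolding measurable_cong_sets[OF sets refl] induced_process_def[abs_def] split_beta'
      by (intro borel_measurable_continuous_onI continuous_intros)
    show "continuous_on {0..1} (\<lambda>t. induced_process ?F t \<omega>)" for \<omega>
      unfolding induced_process_def split_beta' by (intro continuous_intros)
    \<comment> \<open>At times 0 and 1 the square root vanishes and the process returns the first
      and second components.\<close>
    show "distr ?M (borel \<Otimes>\<^sub>M borel) (\<lambda>\<omega>. (induced_process ?F 0 \<omega>, induced_process ?F 1 \<omega>))
        = mvn m0 \<Sigma> \<Otimes>\<^sub>M mvn m1 \<Sigma>"
      using distr_pair_marginals[OF P P P, of m0 m1 0]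
      by (simp add: induced_process_def induced_space_def split_beta')
  qed
  moreover have "\<exists>\<phi> \<phi>'. (\<forall>x. \<phi> 0 x = x)
      \<and> (\<forall>x. \<forall>t\<in>{0..1}. \<phi>' t x = m1 - m0)
      \<and> (\<forall>x. \<forall>t\<in>{0..1}. ((\<lambda>s. \<phi> s x) has_vector_derivative \<phi>' t x) (at t within {0..1}))
      \<and> (\<forall>x. \<forall>t\<in>{0..1}. ((\<lambda>s. \<phi>' s x) has_vector_derivative (0 :: real^'d)) (at t within {0..1}))"
    \<comment> \<open>A constant velocity field moves every point along a straight line at constant
      speed.\<close>
    by (intro exI[of _ "\<lambda>t x. x + t *\<^sub>R (m1 - m0)"] exI[of _ "\<lambda>t x. m1 - m0"])
      (auto intro!: derivative_eq_intros)
  moreover have "\<exists>L>0. \<forall>t\<in>{0..1 :: real}. \<forall>x y :: real^'d. norm ((m1 - m0) - (m1 - m0)) \<le> L * norm (x - y)"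
    by (intro exI[of _ 1]) auto
  ultimately have "in_S_SL ?M (induced_process ?F) (mvn m0 \<Sigma>) (mvn m1 \<Sigma>)"
    unfolding in_S_SL_def
    using is_cond_velocity_sqrt_bridge[OF assms(3), of m0 m1] ac_prob_mvn[OF assms(3)] by blast
  then show ?thesis
    unfolding in_F_SL_def
    using base_path_sqrt_bridge[OF assms(1,2)] ac_prob_mvn[OF assms(3)] by blast
qed

end
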